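(* There is a Jordan loop $\gamma$ in the plane with curvature strictly between $-1$ and $1$ such that the interior region $R$ of $\gamma$ is neither drawable nor closed-disk drawable. However, $R$ is locally drawable and locally closed-disk drawable.
   Context: For $A\subseteq\mathbb{R}^2$ let $N(A)=\{x\in\mathbb{R}^2: |x-a|<1 \text{ for some } a\in A\}$ and $N_{\le}(A)=\{x\in\mathbb{R}^2: |x-a|\le 1 \text{ for some } a\in A\}$. Let $\mathcal{D}_1=\{N(A_1): A_1\subseteq\mathbb{R}^2\}$ and for $n\ge 2$ let $\mathcal{D}_n=\{D\cup N(A_n): D\in\mathcal{D}_{n-1}, A_n\subseteq\mathbb{R}^2\}$ if $n$ is odd and $\mathcal{D}_n=\{D\setminus N(A_n): D\in\mathcal{D}_{n-1}, A_n\subseteq\mathbb{R}^2\}$ if $n$ is even. A set is drawable if it lies in $\mathcal{D}=\bigcup_{n\ge1}\mathcal{D}_n$. The collection $\mathcal{D}_{\le}$ of closed-disk drawable sets is defined in the same way with every $N(\cdot)$ replaced by $N_{\le}(\cdot)$. A set $B\subseteq\mathbb{R}^2$ is locally drawable if every point $x\in\mathbb{R}^2$ has a neighborhood $U$ such that there is $D\in\mathcal{D}$ with $U\cap B=U\cap D$; locally closed-disk drawable is defined analogously with $D\in\mathcal{D}_{\le}$. *)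

theory Defs
  imports "HOL-Analysis.Analysis"
begin

text \<open>The plane R^2 is modelled by the type complex (as in the library's Jordan curve theorem).\<close>

definition open_nbhd :: "complex set \<Rightarrow> complex set" where
  "open_nbhd A = {x. \<exists>a\<in>A. dist x a < 1}"

definition closed_nbhd :: "complex set \<Rightarrow> complex set" where
  "closed_nbhd A = {x. \<exists>a\<in>A. dist x a \<le> 1}"

text \<open>Dlev nb n is the class D_n built with neighbourhood operator nb (index 0 unused, empty).\<close>
fun Dlev :: "(complex set \<Rightarrow> complex set) \<Rightarrow> nat \<Rightarrow> complex set set" where
  "Dlev nb 0 = {}"
| "Dlev nb (Suc n) =
     (if n = 0 then range nb
      else if even n then {D \<union> nb A | D A. D \<in> Dlev nb n}
      else {D - nb A | D A. D \<in> Dlev nb n})"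

definition drawable_with :: "(complex set \<Rightarrow> complex set) \<Rightarrow> complex set \<Rightarrow> bool" where
  "drawable_with nb S \<longleftrightarrow> (\<exists>n\<ge>1. S \<in> Dlev nb n)"

definition drawable :: "complex set \<Rightarrow> bool" where
  "drawable S \<longleftrightarrow> drawable_with open_nbhd S"

definition cdrawable :: "complex set \<Rightarrow> bool" where
  "cdrawable S \<longleftrightarrow> drawable_with closed_nbhd S"

definition locally_drawable_with :: "(complex set \<Rightarrow> complex set) \<Rightarrow> complex set \<Rightarrow> bool" where
  "locally_drawable_with nb B \<longleftrightarrow>
     (\<forall>x. \<exists>U. open U \<and> x \<in> U \<and> (\<exists>D. drawable_with nb D \<and> U \<inter> B = U \<inter> D))"

definition locally_drawable :: "complex set \<Rightarrow> bool" where
  "locally_drawable B \<longleftrightarrow> locally_drawable_with open_nbhd B"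

definition locally_cdrawable :: "complex set \<Rightarrow> bool" where
  "locally_cdrawable B \<longleftrightarrow> locally_drawable_with closed_nbhd B"

definition curvature :: "(real \<Rightarrow> complex) \<Rightarrow> real \<Rightarrow> real" where
  "curvature g t =
     (let d1 = vector_derivative g (at t);
          d2 = vector_derivative (\<lambda>s. vector_derivative g (at s)) (at t)
      in Im (cnj d1 * d2) / (cmod d1) ^ 3)"

definition C2_jordan_loop :: "(real \<Rightarrow> complex) \<Rightarrow> bool" where
  "C2_jordan_loop g \<longleftrightarrow>
     (\<forall>t. g (t + 1) = g t) \<and> simple_path g \<and> pathfinish g = pathstart g \<and>
     (\<forall>t. g differentiable (at t)) \<and>
     (\<forall>t. (\<lambda>s. vector_derivative g (at s)) differentiable (at t)) \<and>
     continuous_on UNIV (\<lambda>t. vector_derivative (\<lambda>s. vector_derivative g (at s)) (at t)) \<and>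
     (\<forall>t. vector_derivative g (at t) \<noteq> 0)"

end

theory Submission
  imports Defs
begin

text \<open>
  If an open set \<open>N\<close> has the property that every unit disk meeting \<open>N\<close> contains in its
  interior a boundary point of \<open>R\<close> lying in \<open>N\<close>, then \<open>R\<close> is not drawable: no brush stroke or
  eraser stroke can touch \<open>N \<inter> R\<close> without touching \<open>N - R\<close> and vice versa. Such an \<open>N\<close> exists
  around a set \<open>S\<close> of points of a smooth curve as soon as both unit disks tangent to the curve at
  any point of \<open>S\<close> contain a further point of \<open>S\<close>. The witness is a gear-shaped curve passing
  two thousand times through a circle in overhanging meanders, \<open>S\<close> being its crossings with the
  circle: consecutive crossings are so close that the tangent disks at each of them contain its two
  neighbours, although the bulb-like turns keep the curvature below 1.

  Local drawability holds for every loop with curvature strictly between -1 and 1: near a curve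
  point, every point off the curve lies in a unit disk, tangent at the nearest curve point,
  which locally does not meet the curve and hence stays on one side.
\<close>

subsection \<open>Traps\<close>

text \<open>By induction on the number of strokes. A final brush stroke either meets
  \<open>P\<close>, hence \<open>Q\<close>, or leaves \<open>P\<close> covered by the earlier set. A
  final eraser stroke that spares \<open>P\<close> misses \<open>Q\<close> as well, so what the
  earlier set has of \<open>Q\<close> survives.\<close>

lemma Dlev_meets_trap:
  assumes trap: "\<And>A. nb A \<inter> P \<noteq> {} \<longleftrightarrow> nb A \<inter> Q \<noteq> {}"
    and "P \<noteq> {}" "D \<in> Dlev nb n" "P \<subseteq> D"
  shows "D \<inter> Q \<noteq> {}"
  using assms(3,4)
proof (induction n arbitrary: D)
  case 0
  then show ?case by simp
next
  case (Suc n)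
  consider (one) A where "D = nb A"
    | (un) E A where "D = E \<union> nb A" "E \<in> Dlev nb n"
    | (diff) E A where "D = E - nb A" "E \<in> Dlev nb n"
    using Suc.prems(1) by (auto split: if_splits)
  then show ?case
  proof cases
    case one
    then show ?thesis using Suc.prems(2) assms(2) trap[of A] by blast
  next
    case un
    then show ?thesis using Suc.IH[of E] Suc.prems(2) trap[of A] by blast
  next
    case diff
    then show ?thesis using Suc.IH[of E] Suc.prems(2) trap[of A] by blast
  qed
qed

text \<open>Passing from a closed ball to an open one in the assumption serves both kinds of stroke
  at once: around a frontier point interior to the disk there are points of \<open>R\<close> and of
  its complement, still in the disk and in \<open>N\<close>. No drawable set can then contain
  \<open>N \<inter> R\<close> and avoid \<open>N - R\<close>, as \<open>R\<close> does.\<close>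

lemma not_drawable_if_trap:
  assumes "open N" "N \<noteq> {}"
    and N: "\<And>c. cball c 1 \<inter> N \<noteq> {} \<Longrightarrow> ball c 1 \<inter> N \<inter> frontier R \<noteq> {}"
  shows "\<not> drawable R" "\<not> cdrawable R"
proof -
  define P where "P = N \<inter> R"
  define Q where "Q = N - R"
  have hits: "ball c 1 \<inter> P \<noteq> {} \<and> ball c 1 \<inter> Q \<noteq> {}" if c: "cball c 1 \<inter> N \<noteq> {}" for c
  proof -
    obtain x where x: "x \<in> ball c 1 \<inter> N" "x \<in> frontier R" using N[OF c] by blast
    have "open (ball c 1 \<inter> N)" using assms(1) by blast
    then obtain e where e: "e > 0" "ball x e \<subseteq> ball c 1 \<inter> N"
      using x(1) by (meson openE)
    from x(2) e(1) have "\<exists>y\<in>R. dist x y < e" "\<exists>y. y \<notin> R \<and> dist x y < e"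
      unfolding frontier_straddle by blast+
    then obtain y y' where "y \<in> R" "y \<in> ball x e" "y' \<notin> R" "y' \<in> ball x e" by auto
    then show ?thesis using e(2) unfolding P_def Q_def by blast
  qed
  have P: "P \<noteq> {}"
  proof -
    obtain x where "x \<in> N" using assms(2) by blast
    then have "cball x 1 \<inter> N \<noteq> {}" by force
    then show ?thesis using hits by blast
  qed
  have "open_nbhd A \<inter> P \<noteq> {} \<longleftrightarrow> open_nbhd A \<inter> Q \<noteq> {}" for A
  proof -
    have *: "open_nbhd A = (\<Union>a\<in>A. ball a 1)" by (auto simp: open_nbhd_def dist_commute)
    have "ball a 1 \<inter> P \<noteq> {} \<longleftrightarrow> ball a 1 \<inter> Q \<noteq> {}" for a
      using hits[of a] ball_subset_cball[of a 1] unfolding P_def Q_def by blast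
    then show ?thesis unfolding * by blast
  qed
  then have "D \<inter> Q \<noteq> {}" if "D \<in> Dlev open_nbhd n" "P \<subseteq> D" for D n
    using Dlev_meets_trap P that by metis
  then show "\<not> drawable R" unfolding drawable_def drawable_with_def P_def Q_def by blast
  have "closed_nbhd A \<inter> P \<noteq> {} \<longleftrightarrow> closed_nbhd A \<inter> Q \<noteq> {}" for A
  proof -
    have *: "closed_nbhd A = (\<Union>a\<in>A. cball a 1)" by (auto simp: closed_nbhd_def dist_commute)
    have "cball a 1 \<inter> P \<noteq> {} \<longleftrightarrow> cball a 1 \<inter> Q \<noteq> {}" for a
      using hits[of a] ball_subset_cball[of a 1] unfolding P_def Q_def by blast
    then show ?thesis unfolding * by blast
  qed
  then have "D \<inter> Q \<noteq> {}" if "D \<in> Dlev closed_nbhd n" "P \<subseteq> D" for D n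
    using Dlev_meets_trap P that by metis
  then show "\<not> cdrawable R" unfolding cdrawable_def drawable_with_def P_def Q_def by blast
qed

section \<open>Tubes around short arcs of a curve\<close>

lemma has_derivative_dist_square:
  fixes g :: "real \<Rightarrow> complex"
  assumes "(g has_vector_derivative d) (at t)"
  shows "((\<lambda>t. (dist c (g t))\<^sup>2) has_real_derivative - 2 * ((c - g t) \<bullet> d)) (at t)"
proof -
  have "((\<lambda>t. (c - g t) \<bullet> (c - g t)) has_derivative
     (\<lambda>x. (c - g t) \<bullet> (0 - x *\<^sub>R d) + (0 - x *\<^sub>R d) \<bullet> (c - g t))) (at t)"
    using assms unfolding has_vector_derivative_def
    by (intro has_derivative_inner has_derivative_diff has_derivative_const) auto
  moreover have "(\<lambda>x. (c - g t) \<bullet> (0 - x *\<^sub>R d) + (0 - x *\<^sub>R d) \<bullet> (c - g t)) = (*) (- 2 * ((c - g t) \<bullet> d))"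
    by (auto simp: fun_eq_iff inner_commute algebra_simps)
  ultimately show ?thesis
    unfolding has_field_derivative_def dist_norm power2_norm_eq_inner by simp
qed

text \<open>The neighbourhood is a tube around a short arc whose radius tapers to zero at both ends
  faster than its length; a disk that enters the tube without crossing the arc is then
  forced to be almost tangent to it.\<close>

lemma trap_neighbourhood:
  fixes g :: "real \<Rightarrow> complex"
  assumes g: "\<And>t. (g has_vector_derivative g' t) (at t)"
    and g': "continuous_on UNIV g'"
    and S: "\<And>c. dist c (g t0) = 1 \<Longrightarrow> (c - g t0) \<bullet> g' t0 = 0 \<Longrightarrow> ball c 1 \<inter> S \<noteq> {}"
  shows "\<exists>N. open N \<and> g t0 \<in> N \<and>
    (\<forall>c. cball c 1 \<inter> N \<noteq> {} \<longrightarrow> ball c 1 \<inter> N \<inter> range g \<noteq> {} \<or> ball c 1 \<inter> S \<noteq> {})"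
proof (rule ccontr)
  assume neg: "\<not> ?thesis"
  \<comment> \<open>\<open>d k\<close> is both the half-length of the parameter window and the scale
    of the tube, whose radius is of order \<open>d k ^ 2\<close>. The failure of every
    \<open>N k\<close> yields a sequence of offending disks.\<close>
  define d where "d k = 1 / real (Suc k)" for k
  have dpos: "d k > 0" for k by (simp add: d_def)
  have d1: "d k \<le> 1" for k by (simp add: d_def)
  have d0: "d \<longlonglongrightarrow> 0" unfolding d_def by (rule LIMSEQ_Suc[OF lim_1_over_n])
  define N where "N k = (\<Union>t\<in>{t. \<bar>t - t0\<bar> < d k}. ball (g t) (d k * (d k - \<bar>t - t0\<bar>)))" for k
  have gN: "g t \<in> N k" if "\<bar>t - t0\<bar> < d k" for t k
    using that dpos[of k] unfolding N_def by force
  have "\<exists>c t. \<bar>t - t0\<bar> < d k \<and> dist c (g t) < 1 + d k * (d k - \<bar>t - t0\<bar>) \<and>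
      ball c 1 \<inter> N k \<inter> range g = {} \<and> ball c 1 \<inter> S = {}" for k
  proof -
    have "open (N k)" unfolding N_def by blast
    moreover have "g t0 \<in> N k" using gN dpos by simp
    ultimately obtain c where c: "cball c 1 \<inter> N k \<noteq> {}" "ball c 1 \<inter> N k \<inter> range g = {}" "ball c 1 \<inter> S = {}"
      using neg by blast
    then obtain z t where z: "dist c z \<le> 1" "\<bar>t - t0\<bar> < d k" "dist (g t) z < d k * (d k - \<bar>t - t0\<bar>)"
      unfolding N_def by auto
    have "dist c (g t) \<le> dist c z + dist (g t) z" by (metis dist_commute dist_triangle)
    then show ?thesis using z c by (intro exI[of _ c] exI[of _ t]) auto
  qed
  then obtain c t where ct: "\<And>k. \<bar>t k - t0\<bar> < d k"
      "\<And>k. dist (c k) (g (t k)) < 1 + d k * (d k - \<bar>t k - t0\<bar>)"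
      "\<And>k. ball (c k) 1 \<inter> N k \<inter> range g = {}" "\<And>k. ball (c k) 1 \<inter> S = {}"
    by metis
  have far: "dist (c k) (g s) \<ge> 1" if "\<bar>s - t0\<bar> < d k" for s k
  proof -
    have "g s \<notin> ball (c k) 1" using ct(3)[of k] gN[OF that] by blast
    then show ?thesis by simp
  qed
  have gcont: "isCont g s" for s using g has_vector_derivative_continuous by blast
  have g'cont: "isCont g' s" for s using g' by (simp add: continuous_on_eq_continuous_at)
  have tendt0: "s \<longlonglongrightarrow> t0" if "\<And>k. \<bar>s k - t0\<bar> < d k" for s
  proof -
    have "(\<lambda>k. s k - t0) \<longlonglongrightarrow> 0"
      by (rule Lim_null_comparison[OF _ d0]) (use that in \<open>auto intro!: always_eventually less_imp_le\<close>)
    then show ?thesis by (simp add: LIM_zero_iff)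
  qed
  have tt: "t \<longlonglongrightarrow> t0" using tendt0 ct(1) by blast
  have gt: "(\<lambda>k. g (t k)) \<longlonglongrightarrow> g t0" by (rule isCont_tendsto_compose[OF gcont tt])
  have near: "dist (c k) (g (t k)) < 1 + d k" for k
  proof -
    have "d k * (d k - \<bar>t k - t0\<bar>) \<le> d k * 1" using d1[of k] dpos[of k]
      by (intro mult_left_mono) auto
    then show ?thesis using ct(2)[of k] by simp
  qed
  have dist1: "(\<lambda>k. dist (c k) (g (t k))) \<longlonglongrightarrow> 1"
  proof (rule tendsto_sandwich[of "\<lambda>_. 1" _ _ "\<lambda>k. 1 + d k"])
    show "(\<lambda>k. 1 + d k) \<longlonglongrightarrow> 1" using tendsto_add[OF tendsto_const d0, of 1] by simp
  qed (use near far[OF ct(1)] in \<open>auto intro!: always_eventually less_imp_le\<close>)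
  have "bounded (range (\<lambda>k. c k))"
  proof -
    obtain B where B: "\<And>k. norm (g (t k)) \<le> B"
      using convergent_imp_bounded[OF gt] by (auto simp: bounded_iff)
    have "norm (c k) \<le> B + 2" for k
    proof -
      have "norm (c k) \<le> norm (c k - g (t k)) + norm (g (t k))" by norm
      then show ?thesis using near[of k] d1[of k] B[of k] by (simp add: dist_norm)
    qed
    then show ?thesis by (auto simp: bounded_iff)
  qed
  \<comment> \<open>A limit disk with centre \<open>l\<close> has \<open>g t0\<close> on its
    boundary circle; what remains is its tangency to the curve there.\<close>
  then obtain l r where r: "strict_mono r" and l: "(c \<circ> r) \<longlonglongrightarrow> l"
    using bounded_imp_convergent_subsequence[of c] by blast
  have gtr: "(\<lambda>k. g (t (r k))) \<longlonglongrightarrow> g t0"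
    using LIMSEQ_subseq_LIMSEQ[OF gt r] by (simp add: o_def)
  have lr: "(\<lambda>k. c (r k)) \<longlonglongrightarrow> l" using l by (simp add: o_def)
  have dr: "(\<lambda>k. d (r k)) \<longlonglongrightarrow> 0" using LIMSEQ_subseq_LIMSEQ[OF d0 r] by (simp add: o_def)
  have dl: "dist l (g t0) = 1"
    using LIMSEQ_unique[OF tendsto_dist[OF lr gtr]]
      LIMSEQ_subseq_LIMSEQ[OF dist1 r] by (simp add: o_def)
  \<comment> \<open>In either direction \<open>e\<close> along the curve, the squared distance to
    \<open>l\<close> does not decrease to first order at \<open>t0\<close>. The two signs together
    make its derivative vanish.\<close>
  have slope: "0 \<le> - 2 * e * ((l - g t0) \<bullet> g' t0)" if e: "e = 1 \<or> e = - 1" for e :: real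
  proof -
    \<comment> \<open>\<open>\<rho> k\<close> is the parameter length left up to the nearer end of
      the window. Over a step of \<open>\<rho> k / 2\<close> the squared distance starts below
      \<open>(1 + d k * \<rho> k)^2\<close> and ends at 1 or more, so it drops by at most
      \<open>3 * d k * \<rho> k\<close>. The mean value theorem then gives a slope of at least
      \<open>- 6 * d k\<close>, which tends to 0.\<close>
    define \<rho> where "\<rho> k = d k - \<bar>t k - t0\<bar>" for k
    have \<rho>: "0 < \<rho> k" "\<rho> k \<le> d k" for k using ct(1)[of k] by (auto simp: \<rho>_def)
    have "\<exists>\<xi>. \<bar>\<xi> - t0\<bar> < d k \<and> - 2 * e * ((c k - g \<xi>) \<bullet> g' \<xi>) \<ge> - 6 * d k" for k
    proof -
      define h where "h s = (dist (c k) (g (t k + e * s)))\<^sup>2" for s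
      have h': "(h has_real_derivative (- 2 * e * ((c k - g (t k + e * s)) \<bullet> g' (t k + e * s)))) (at s)" for s
        unfolding h_def
        by (rule DERIV_cong[OF DERIV_chain2[where f = "\<lambda>x. (dist (c k) (g x))\<^sup>2" and g = "\<lambda>s. t k + e * s",
              OF has_derivative_dist_square[OF g]]])
          (auto intro!: derivative_eq_intros)
      have "0 < \<rho> k / 2" using \<rho>(1)[of k] by simp
      then obtain s where s: "0 < s" "s < \<rho> k / 2"
        "h (\<rho> k / 2) - h 0 = (\<rho> k / 2 - 0) * (- 2 * e * ((c k - g (t k + e * s)) \<bullet> g' (t k + e * s)))"
        using MVT2[where f = h and f' = "\<lambda>s. - 2 * e * ((c k - g (t k + e * s)) \<bullet> g' (t k + e * s))", OF _ h', of 0 "\<rho> k / 2"]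
        by metis
      have in1: "\<bar>(t k + e * s) - t0\<bar> < d k" if "0 \<le> s" "s \<le> \<rho> k / 2" for s
        using that \<rho>(1)[of k] e unfolding \<rho>_def by auto
      have "1 \<le> h (\<rho> k / 2)"
        unfolding h_def using far[OF in1[of "\<rho> k / 2"]] \<rho>(1)[of k] by (simp add: one_le_power)
      moreover have "h 0 \<le> 1 + 3 * d k * \<rho> k"
      proof -
        have "0 \<le> d k * \<rho> k" "d k * \<rho> k \<le> 1"
          using dpos[of k] \<rho>[of k] d1[of k] by (auto simp: mult_le_one)
        then have "(d k * \<rho> k)\<^sup>2 \<le> d k * \<rho> k" by (simp add: power2_eq_square mult_left_le)
        moreover have "h 0 \<le> (1 + d k * \<rho> k)\<^sup>2"
          unfolding h_def using ct(2)[of k] by (intro power_mono) (auto simp: \<rho>_def)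
        ultimately show ?thesis by (simp add: power2_sum)
      qed
      ultimately have "\<rho> k * (- 3 * d k) \<le> (\<rho> k / 2) * (- 2 * e * ((c k - g (t k + e * s)) \<bullet> g' (t k + e * s)))"
        using s(3) by (simp add: algebra_simps)
      then have "\<rho> k * (- 6 * d k) \<le> \<rho> k * (- 2 * e * ((c k - g (t k + e * s)) \<bullet> g' (t k + e * s)))"
        by (simp add: mult_ac)
      then have "- 6 * d k \<le> - 2 * e * ((c k - g (t k + e * s)) \<bullet> g' (t k + e * s))"
        using \<rho>(1)[of k] by (rule mult_left_le_imp_le)
      then show ?thesis using in1[of s] s(1,2) by (intro exI[of _ "t k + e * s"]) auto
    qed
    then obtain \<xi> where \<xi>: "\<And>k. \<bar>\<xi> k - t0\<bar> < d k" "\<And>k. - 2 * e * ((c k - g (\<xi> k)) \<bullet> g' (\<xi> k)) \<ge> - 6 * d k"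
      by metis
    have \<xi>r: "(\<lambda>k. \<xi> (r k)) \<longlonglongrightarrow> t0"
      using LIMSEQ_subseq_LIMSEQ[OF tendt0[OF \<xi>(1)] r] by (simp add: o_def)
    have lim: "(\<lambda>k. - 2 * e * ((c (r k) - g (\<xi> (r k))) \<bullet> g' (\<xi> (r k)))) \<longlonglongrightarrow> - 2 * e * ((l - g t0) \<bullet> g' t0)"
      by (intro tendsto_intros lr isCont_tendsto_compose[OF gcont] isCont_tendsto_compose[OF g'cont] \<xi>r)
    have "(\<lambda>k. - 6 * d (r k)) \<longlonglongrightarrow> - 6 * 0" by (intro tendsto_intros dr)
    then have "- 6 * 0 \<le> - 2 * e * ((l - g t0) \<bullet> g' t0)"
      by (rule LIMSEQ_le[OF _ lim]) (use \<xi>(2) in blast)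
    then show ?thesis by simp
  qed
  \<comment> \<open>By tangency some point of \<open>S\<close> is strictly inside the limit disk,
    hence inside a disk of the sequence, against its choice.\<close>
  have "(l - g t0) \<bullet> g' t0 = 0" using slope[of 1] slope[of "-1"] by auto
  then obtain s where s: "s \<in> S" "dist l s < 1" using S[OF dl] by auto
  have "(\<lambda>k. dist (c (r k)) s) \<longlonglongrightarrow> dist l s" by (intro tendsto_intros lr)
  then have "eventually (\<lambda>k. dist (c (r k)) s < 1) sequentially" using s(2) by (rule order_tendstoD)
  then obtain k where "dist (c (r k)) s < 1" by (auto simp: eventually_sequentially)
  then show False using ct(4)[of "r k"] s(1) by auto
qed

subsection \<open>Local drawability\<close>

text \<open>Multiplication by \<open>cnj (sgn d)\<close> rotates \<open>d\<close> onto the positive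
  real axis, so \<open>u\<close> becomes a purely imaginary unit.\<close>

lemma unit_normal_cases:
  fixes u d :: complex
  assumes "norm u = 1" "u \<bullet> d = 0" "d \<noteq> 0"
  obtains \<epsilon> :: real where "\<epsilon> = 1 \<or> \<epsilon> = -1" "u = \<epsilon> *\<^sub>R (\<i> * sgn d)"
proof -
  define v where "v = cnj (sgn d) * u"
  have dv: "sgn d * v = u"
    using assms(3) complex_norm_square[of "sgn d"] by (simp add: v_def norm_sgn flip: mult.assoc)
  have "Re v = 0" using assms(2)
    by (simp add: v_def inner_complex_def sgn_eq field_simps)
  moreover have "norm v = 1" using assms by (simp add: v_def norm_mult norm_sgn)
  ultimately have "\<bar>Im v\<bar> = 1" by (simp add: cmod_def)
  moreover have "v = \<i> * Im v" using \<open>Re v = 0\<close> by (simp add: complex_eq_iff)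
  ultimately have "Im v = 1 \<or> Im v = -1" "u = Im v *\<^sub>R (\<i> * sgn d)"
    using dv by (auto simp: scaleR_conv_of_real mult_ac)
  then show ?thesis using that by blast
qed

text \<open>For fixed \<open>s\<close>, the squared distance from the centre \<open>g s + u\<close>
  to \<open>g t\<close> is convex in \<open>t\<close> near \<open>t0\<close>, equals 1 at
  \<open>t = s\<close> and has zero derivative there. Convexity at \<open>t0\<close> is the
  curvature bound; continuity in \<open>(s, t)\<close> spreads it to a neighbourhood.\<close>

lemma tangent_disk_avoids_arc:
  fixes g :: "real \<Rightarrow> complex"
  assumes g: "\<And>t. (g has_vector_derivative g' t) (at t)"
    and g': "\<And>t. (g' has_vector_derivative g'' t) (at t)"
    and g'': "continuous_on UNIV g''"
    and nz: "\<And>t. g' t \<noteq> 0"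
    and curv: "\<bar>Im (cnj (g' t0) * g'' t0)\<bar> < cmod (g' t0) ^ 3"
  obtains \<delta> where "\<delta> > 0" "\<And>s t u. \<bar>s - t0\<bar> < \<delta> \<Longrightarrow> \<bar>t - t0\<bar> < \<delta> \<Longrightarrow> norm u = 1 \<Longrightarrow>
    u \<bullet> g' s = 0 \<Longrightarrow> 1 \<le> dist (g s + u) (g t)"
proof -
  \<comment> \<open>half the second derivative of the squared distance from g t to the centre of a
    unit disk tangent to the curve at g s\<close>
  define F where "F \<epsilon> p = (let s = fst p; t = snd p in
    g' t \<bullet> g' t + (g t - (g s + \<epsilon> *\<^sub>R (\<i> * sgn (g' s)))) \<bullet> g'' t)" for \<epsilon> :: real and p :: "real \<times> real"
  have cont: "continuous_on UNIV g" "continuous_on UNIV g'"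
    using has_vector_derivative_continuous[OF g] has_vector_derivative_continuous[OF g']
    by (simp_all add: continuous_on_eq_continuous_at)
  \<comment> \<open>On the diagonal the term \<open>g t - g s\<close> cancels and \<open>F\<close>
    is the squared speed minus \<open>\<epsilon>\<close> times the normal part of
    \<open>g''\<close>; positivity for both signs is the curvature bound.\<close>
  have F0: "F \<epsilon> (t0, t0) > 0" if "\<epsilon> = 1 \<or> \<epsilon> = -1" for \<epsilon>
  proof -
    have "(\<i> * sgn (g' t0)) \<bullet> g'' t0 = Im (cnj (g' t0) * g'' t0) / cmod (g' t0)"
      by (simp add: inner_complex_def sgn_eq diff_divide_distrib mult_ac)
    moreover have "\<bar>Im (cnj (g' t0) * g'' t0) / cmod (g' t0)\<bar> < (cmod (g' t0))\<^sup>2"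
      using curv nz[of t0] by (simp add: abs_divide divide_less_eq power2_eq_square power3_eq_cube)
    ultimately have "\<bar>(\<i> * sgn (g' t0)) \<bullet> g'' t0\<bar> < (cmod (g' t0))\<^sup>2" by (simp only:)
    then show ?thesis
      using that by (auto simp: F_def power2_norm_eq_inner[symmetric] abs_less_iff)
  qed
  have "continuous_on UNIV (F \<epsilon>)" for \<epsilon>
    unfolding F_def Let_def sgn_div_norm
    by (intro continuous_intros continuous_on_compose2[OF cont(1)] continuous_on_compose2[OF cont(2)]
        continuous_on_compose2[OF g'']) (auto simp: nz)
  then have "(F \<epsilon> \<longlongrightarrow> F \<epsilon> (t0, t0)) (nhds (t0, t0))" for \<epsilon>
    by (simp add: continuous_on_eq_continuous_at isCont_def tendsto_at_iff_tendsto_nhds)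
  then have "eventually (\<lambda>p. F \<epsilon> p > 0) (nhds (t0, t0))" if "\<epsilon> = 1 \<or> \<epsilon> = -1" for \<epsilon>
    using F0[OF that] by (rule order_tendstoD(1))
  then have "eventually (\<lambda>p. F 1 p > 0 \<and> F (-1) p > 0) (nhds t0 \<times>\<^sub>F nhds t0)"
    by (simp add: eventually_conj nhds_prod)
  then obtain P Q where PQ: "eventually P (nhds t0)" "eventually Q (nhds t0)"
    "\<And>s t. P s \<Longrightarrow> Q t \<Longrightarrow> F 1 (s, t) > 0 \<and> F (-1) (s, t) > 0"
    unfolding eventually_prod_filter by auto
  then have "eventually (\<lambda>t. P t \<and> Q t) (nhds t0)" by (simp add: eventually_conj)
  then obtain \<delta> where \<delta>: "\<delta> > 0" "\<And>t. \<bar>t - t0\<bar> < \<delta> \<Longrightarrow> P t \<and> Q t"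
    unfolding eventually_nhds_metric dist_real_def by auto
  show ?thesis
  proof (rule that[OF \<delta>(1)])
    fix s t and u :: complex
    assume st: "\<bar>s - t0\<bar> < \<delta>" "\<bar>t - t0\<bar> < \<delta>" and u: "norm u = 1" "u \<bullet> g' s = 0"
    obtain \<epsilon> :: real where \<epsilon>: "\<epsilon> = 1 \<or> \<epsilon> = -1" "u = \<epsilon> *\<^sub>R (\<i> * sgn (g' s))"
      using unit_normal_cases[OF u nz] by blast
    define c where "c = g s + u"
    define h where "h t = (g t - c) \<bullet> (g t - c)" for t
    define h' where "h' t = 2 * ((g t - c) \<bullet> g' t)" for t
    define h'' where "h'' t = 2 * (g' t \<bullet> g' t + (g t - c) \<bullet> g'' t)" for t
    let ?C = "{t0 - \<delta><..<t0 + \<delta>}"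
    have gd: "((\<lambda>t. g t - c) has_derivative (\<lambda>x. x *\<^sub>R g' t)) (at t)" for t
      using has_derivative_diff[OF g[of t, unfolded has_vector_derivative_def] has_derivative_const[of c]]
      by simp
    have gd': "(g' has_derivative (\<lambda>x. x *\<^sub>R g'' t)) (at t)" for t
      using g'[of t] unfolding has_vector_derivative_def .
    have "(h has_real_derivative h' t) (at t)" for t
      using has_derivative_inner[OF gd gd, of t] unfolding has_field_derivative_def h_def h'_def
      by (rule has_derivative_eq_rhs) (auto simp: fun_eq_iff inner_commute)
    moreover have "(h' has_real_derivative h'' t) (at t)" for t
      using has_derivative_mult_right[OF has_derivative_inner[OF gd gd', of t], of 2]
      unfolding has_field_derivative_def h'_def h''_def
      by (rule has_derivative_eq_rhs) (auto simp: fun_eq_iff algebra_simps)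
    moreover have "h'' t \<ge> 0" if "t \<in> ?C" for t
    proof -
      have "\<bar>t - t0\<bar> < \<delta>" using that by auto
      then have "F \<epsilon> (s, t) > 0" using PQ(3)[of s t] \<delta>(2) st(1) \<epsilon>(1) by auto
      then show ?thesis by (simp add: h''_def c_def F_def \<epsilon>(2))
    qed
    moreover have "s \<in> ?C" "t \<in> ?C" using st by auto
    \<comment> \<open>A convex function lies above its tangent line at \<open>s\<close>, which here
      is the constant 1.\<close>
    ultimately have "h' s * (t - s) \<le> h t - h s"
      using f''_imp_f'[of ?C h h' h'' s t] by auto
    moreover have "h' s = 0" using u(2) by (simp add: h'_def c_def)
    moreover have "h s = 1" using u(1) by (simp add: h_def c_def power2_norm_eq_inner[symmetric])
    moreover have "h t = (dist c (g t))\<^sup>2"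
      by (simp add: h_def dist_norm norm_minus_commute[of c] power2_norm_eq_inner)
    ultimately have "1\<^sup>2 \<le> (dist c (g t))\<^sup>2" by simp
    then show "1 \<le> dist (g s + u) (g t)"
      unfolding c_def by (rule power2_le_imp_le) simp
  qed
qed

text \<open>Periodicity reduces both parameters to their fractional parts. These are less than 1, so
  the endpoint exception in \<open>loop_free\<close> cannot occur.\<close>

lemma C2_jordan_loop_eq_iff:
  assumes "C2_jordan_loop g"
  shows "g s = g t \<longleftrightarrow> s - t \<in> \<int>"
proof -
  have per: "g (t + 1) = g t" for t using assms by (auto simp: C2_jordan_loop_def)
  have nat: "g (t + real n) = g t" for t n
    by (induction n arbitrary: t) (use per in \<open>auto simp: add.assoc[symmetric] add.commute[of 1]\<close>)
  have int: "g (t + real_of_int k) = g t" for t k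
  proof (cases "k \<ge> 0")
    case True
    then show ?thesis using nat[of t "nat k"] by simp
  next
    case False
    then show ?thesis using nat[of "t + real_of_int k" "nat (-k)"] by simp
  qed
  have fr: "g (frac t) = g t" for t using int[of t "- \<lfloor>t\<rfloor>"] by (simp add: frac_def)
  have lf: "loop_free g" using assms by (auto simp: C2_jordan_loop_def simple_path_def)
  show ?thesis
  proof
    assume "g s = g t"
    then have "g (frac s) = g (frac t)" using fr by simp
    moreover have "frac s \<in> {0..1}" "frac t \<in> {0..1}" "frac s \<noteq> 1" "frac t \<noteq> 1"
      using frac_lt_1[of s] frac_lt_1[of t] by (auto simp: less_imp_le)
    ultimately have "frac s = frac t" using lf unfolding loop_free_def by blast
    then have "s - t = of_int (\<lfloor>s\<rfloor> - \<lfloor>t\<rfloor>)" by (simp add: frac_def)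
    then show "s - t \<in> \<int>" by (metis Ints_of_int)
  next
    assume "s - t \<in> \<int>"
    then obtain k where "s - t = of_int k" by (auto elim: Ints_cases)
    then show "g s = g t" using int[of t k] by (simp add: algebra_simps)
  qed
qed

lemma range_eq_path_image:
  assumes "C2_jordan_loop g"
  shows "range g = path_image g"
proof -
  have "g t \<in> path_image g" for t
  proof -
    have "g t = g (frac t)" using C2_jordan_loop_eq_iff[OF assms, of t "frac t"] by (simp add: frac_def)
    moreover have "frac t \<in> {0..1}" by (simp add: frac_lt_1 less_imp_le)
    ultimately show ?thesis unfolding path_image_def by blast
  qed
  then show ?thesis unfolding path_image_def by blast
qed

text \<open>The part of the loop whose parameters stay at least \<open>\<delta>\<close> away from
  \<open>t0\<close> modulo 1 is compact and misses \<open>g t0\<close>, so it keeps a positive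
  distance from it.\<close>

lemma near_point_near_parameter:
  assumes J: "C2_jordan_loop g" and "\<delta> > 0"
  obtains r where "r > 0" "\<And>t. dist (g t0) (g t) < r \<Longrightarrow> \<exists>s. g s = g t \<and> \<bar>s - t0\<bar> < \<delta>"
proof -
  have "\<And>t. isCont g t" using J unfolding C2_jordan_loop_def by (meson differentiable_imp_continuous_within)
  then have cont: "continuous_on UNIV g" by (simp add: continuous_on_eq_continuous_at)
  define K where "K = g ` {t0 + \<delta> .. t0 + 1 - \<delta>}"
  have "compact K" unfolding K_def
    by (rule compact_continuous_image[OF continuous_on_subset[OF cont]]) auto
  moreover have "g t0 \<notin> K"
  proof
    assume "g t0 \<in> K"
    then obtain t where t: "t0 + \<delta> \<le> t" "t \<le> t0 + 1 - \<delta>" "g t = g t0" unfolding K_def by auto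
    then have "t - t0 \<in> \<int>" using C2_jordan_loop_eq_iff[OF J] by blast
    then obtain k where k: "t - t0 = of_int k" by (auto elim: Ints_cases)
    then have "0 < k" "k < 1" using t \<open>\<delta> > 0\<close> by linarith+
    then show False by simp
  qed
  ultimately obtain r where r: "r > 0" "\<And>y. y \<in> K \<Longrightarrow> r \<le> dist (g t0) y"
    using separate_point_closed[of K "g t0"] compact_imp_closed by blast
  show ?thesis
  proof (rule that[OF r(1)])
    fix t assume t: "dist (g t0) (g t) < r"
    \<comment> \<open>\<open>s\<close> represents \<open>t\<close> in \<open>[t0, t0 + 1)\<close>.
      Outside the window of \<open>K\<close> it is either close to \<open>t0\<close> or close to
      \<open>t0 + 1\<close>, and then \<open>s - 1\<close> is the parameter wanted.\<close>
    define s where "s = t0 + frac (t - t0)"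
    have eq: "g s = g t" "g (s - 1) = g t"
      using C2_jordan_loop_eq_iff[OF J, of s t] C2_jordan_loop_eq_iff[OF J, of "s - 1" t]
      by (auto simp: s_def frac_def)
    then have "g s \<notin> K" using r(2)[of "g s"] t by force
    then have "s \<notin> {t0 + \<delta> .. t0 + 1 - \<delta>}" unfolding K_def by blast
    then have "\<bar>s - t0\<bar> < \<delta> \<or> \<bar>s - 1 - t0\<bar> < \<delta>"
      using frac_lt_1[of "t - t0"] frac_ge_0[of "t - t0"] unfolding s_def by auto
    then show "\<exists>s. g s = g t \<and> \<bar>s - t0\<bar> < \<delta>" using eq by blast
  qed
qed

text \<open>The disk of unit radius that is tangent to the curve at the point nearest to \<open>y\<close>, on the
  side of \<open>y\<close>. No orientation of the curve is needed.\<close>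

lemma local_touching_disk:
  assumes J: "C2_jordan_loop g" and curv: "\<And>t. -1 < curvature g t \<and> curvature g t < 1"
    and x: "x \<in> path_image g"
  obtains r where "r > 0" "\<And>y. y \<in> ball x r \<Longrightarrow> y \<notin> path_image g \<Longrightarrow>
    \<exists>c. y \<in> ball c 1 \<and> ball c 1 \<inter> ball x r \<inter> path_image g = {}"
proof -
  define g' where "g' t = vector_derivative g (at t)" for t
  define g'' where "g'' t = vector_derivative g' (at t)" for t
  have g: "(g has_vector_derivative g' t) (at t)" for t
    using J by (auto simp: C2_jordan_loop_def g'_def vector_derivative_works)
  have g': "(g' has_vector_derivative g'' t) (at t)" for t
    using J unfolding g''_def vector_derivative_works[symmetric] by (auto simp: C2_jordan_loop_def g'_def[abs_def])
  have g'': "continuous_on UNIV g''"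
    using J by (auto simp: C2_jordan_loop_def g''_def[abs_def] g'_def[abs_def])
  have nz: "g' t \<noteq> 0" for t using J by (auto simp: C2_jordan_loop_def g'_def)
  obtain t0 where t0: "x = g t0" using x by (auto simp: path_image_def)
  have "curvature g t0 = Im (cnj (g' t0) * g'' t0) / cmod (g' t0) ^ 3"
    by (simp add: curvature_def Let_def g''_def g'_def[abs_def])
  moreover have "cmod (g' t0) ^ 3 > 0" using nz by simp
  ultimately have "\<bar>Im (cnj (g' t0) * g'' t0)\<bar> < cmod (g' t0) ^ 3"
    using curv[of t0] by (simp add: abs_less_iff field_simps)
  then obtain \<delta> where \<delta>: "\<delta> > 0" "\<And>s t u. \<bar>s - t0\<bar> < \<delta> \<Longrightarrow> \<bar>t - t0\<bar> < \<delta> \<Longrightarrow> norm u = 1 \<Longrightarrow>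
    u \<bullet> g' s = 0 \<Longrightarrow> 1 \<le> dist (g s + u) (g t)"
    using tangent_disk_avoids_arc[OF g g' g'' nz] by blast
  obtain R where R: "R > 0" "\<And>t. dist (g t0) (g t) < R \<Longrightarrow> \<exists>s. g s = g t \<and> \<bar>s - t0\<bar> < \<delta>"
    using near_point_near_parameter[OF J \<delta>(1)] by blast
  \<comment> \<open>The half of \<open>R\<close> keeps the point \<open>q\<close> nearest to
    \<open>y\<close> within \<open>R\<close> of \<open>x\<close>; the bound 1 puts \<open>y\<close>
    inside the unit disk that touches the curve at \<open>q\<close>.\<close>
  define r where "r = min (R / 2) 1"
  show ?thesis
  proof (rule that[of r])
    show "r > 0" using R by (simp add: r_def)
    fix y assume y: "y \<in> ball x r" "y \<notin> path_image g"
    have "closed (path_image g)" "path_image g \<noteq> {}"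
      using J by (auto simp: C2_jordan_loop_def closed_simple_path_image path_image_nonempty)
    then obtain q where q: "q \<in> path_image g" "\<And>z. z \<in> path_image g \<Longrightarrow> dist y q \<le> dist y z"
      using distance_attains_inf[of "path_image g" y] by blast
    have yq: "dist y q < r" using q(2)[OF x] y(1) by (simp add: dist_commute)
    have "dist (g t0) q < R"
      using dist_triangle[of x q y] yq y(1) by (simp add: t0 r_def)
    then obtain s where s: "g s = q" "\<bar>s - t0\<bar> < \<delta>"
      using R(2) q(1) unfolding path_image_def by blast
    have "- 2 * ((y - g s) \<bullet> g' s) = 0"
    proof (rule DERIV_local_min[OF has_derivative_dist_square[OF g] zero_less_one])
      have "dist y (g s) \<le> dist y (g z)" for z
        using q(2) s(1) range_eq_path_image[OF J] by blast
      then show "\<forall>z. \<bar>s - z\<bar> < 1 \<longrightarrow> (dist y (g s))\<^sup>2 \<le> (dist y (g z))\<^sup>2"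
        by (simp add: power_mono)
    qed
    then have perp: "(y - q) \<bullet> g' s = 0" using s(1) by simp
    have "y \<noteq> q" using y(2) q(1) by blast
    define u where "u = sgn (y - q)"
    have u: "norm u = 1" "u \<bullet> g' s = 0"
      using \<open>y \<noteq> q\<close> perp by (auto simp: u_def norm_sgn sgn_div_norm)
    have "y - (q + u) = (1 - 1 / norm (y - q)) *\<^sub>R (y - q)"
      by (simp add: u_def sgn_div_norm algebra_simps divide_inverse)
    then have "norm (y - (q + u)) = \<bar>1 - 1 / norm (y - q)\<bar> * norm (y - q)" by simp
    also have "\<dots> = \<bar>norm (y - q) - 1\<bar>"
      using \<open>y \<noteq> q\<close> by (simp add: abs_mult_pos[symmetric] field_simps)
    also have "\<dots> < 1" using yq \<open>y \<noteq> q\<close> by (simp add: r_def dist_norm abs_less_iff)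
    finally have "y \<in> ball (q + u) 1" by (simp add: dist_norm norm_minus_commute)
    moreover have "z \<notin> ball (q + u) 1" if z: "z \<in> ball x r" "z \<in> path_image g" for z
    proof -
      have "dist (g t0) z < R" using z(1) R(1) by (simp add: r_def t0)
      then obtain t where "g t = z" "\<bar>t - t0\<bar> < \<delta>"
        using R(2) z(2) unfolding path_image_def by blast
      then show ?thesis using \<delta>(2)[OF s(2) _ u, of t] s(1) by simp
    qed
    ultimately show "\<exists>c. y \<in> ball c 1 \<and> ball c 1 \<inter> ball x r \<inter> path_image g = {}" by blast
  qed
qed

section \<open>Painting and erasing near the curve\<close>

lemma nbhd_UNIV: "open_nbhd UNIV = UNIV" "closed_nbhd UNIV = UNIV"
  using zero_less_one zero_le_one dist_self unfolding open_nbhd_def closed_nbhd_def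
  by (metis (mono_tags, lifting) UNIV_I UNIV_eq_I mem_Collect_eq)+

text \<open>At a curve point the two notions need different drawings. With open disks, the inside is
  locally the union of all disks that locally stay inside. With closed disks, it is what is left of
  the full plane after erasing all disks whose interiors locally miss it.\<close>

lemma locally_drawable_inside:
  assumes J: "C2_jordan_loop g" and curv: "\<And>t. -1 < curvature g t \<and> curvature g t < 1"
  shows "locally_drawable (inside (path_image g))" "locally_cdrawable (inside (path_image g))"
proof -
  let ?R = "inside (path_image g)" and ?O = "outside (path_image g)"
  have sp: "simple_path g" "pathfinish g = pathstart g" using J by (auto simp: C2_jordan_loop_def)
  have opens: "open ?R" "open ?O" "?R \<inter> ?O = {}" "?R \<union> ?O = - path_image g"
    "frontier ?O = path_image g"
    using Jordan_inside_outside[OF sp] by auto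
  have all: "drawable_with open_nbhd UNIV" "drawable_with closed_nbhd UNIV"
    unfolding drawable_with_def
    by (rule exI[of _ 1], use nbhd_UNIV in \<open>force intro: range_eqI[symmetric]\<close>)+
  have none: "drawable_with open_nbhd {}" "drawable_with closed_nbhd {}"
    unfolding drawable_with_def
    by (rule exI[of _ 1], force simp: open_nbhd_def closed_nbhd_def)+
  \<comment> \<open>Away from the curve, the inside or the outside is itself a neighbourhood, on
    which the region agrees with the plane or with the empty set.\<close>
  have off: "\<exists>U. open U \<and> x \<in> U \<and> (\<exists>D. drawable_with nb D \<and> U \<inter> ?R = U \<inter> D)"
    if "x \<notin> path_image g" "drawable_with nb UNIV" "drawable_with nb {}" for x nb
  proof (cases "x \<in> ?R")
    case True
    then show ?thesis using opens that by (intro exI[of _ ?R]) blast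
  next
    case False
    then show ?thesis using opens that by (intro exI[of _ ?O]) blast
  qed
  have on: "\<exists>r>0. (\<forall>y\<in>ball x r \<inter> ?R. \<exists>c. y \<in> ball c 1 \<and> ball c 1 \<inter> ball x r \<subseteq> ?R) \<and>
      (\<forall>y\<in>ball x r \<inter> ?O. \<exists>c. y \<in> ball c 1 \<and> ball c 1 \<inter> ball x r \<inter> ?R = {})"
    if x: "x \<in> path_image g" for x
  proof -
    obtain r where r: "r > 0" "\<And>y. y \<in> ball x r \<Longrightarrow> y \<notin> path_image g \<Longrightarrow>
      \<exists>c. y \<in> ball c 1 \<and> ball c 1 \<inter> ball x r \<inter> path_image g = {}"
      using local_touching_disk[OF J curv x] by blast
    \<comment> \<open>The intersection of two disks is convex, so if it avoids the curve it cannot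
      reach both sides.\<close>
    have one_side: "ball c 1 \<inter> ball x r \<subseteq> ?R \<or> ball c 1 \<inter> ball x r \<subseteq> ?O"
      if "ball c 1 \<inter> ball x r \<inter> path_image g = {}" for c
    proof -
      have "connected (ball c 1 \<inter> ball x r)" by (intro convex_connected convex_Int) auto
      then show ?thesis
        using connectedD[of "ball c 1 \<inter> ball x r" ?R ?O] opens that by blast
    qed
    show ?thesis
    proof (rule exI[of _ r], intro conjI ballI r(1))
      fix y assume y: "y \<in> ball x r \<inter> ?R"
      then obtain c where "y \<in> ball c 1" "ball c 1 \<inter> ball x r \<inter> path_image g = {}"
        using r(2)[of y] opens(4) by blast
      then show "\<exists>c. y \<in> ball c 1 \<and> ball c 1 \<inter> ball x r \<subseteq> ?R"
        using one_side[of c] y opens(3) by blast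
    next
      fix y assume y: "y \<in> ball x r \<inter> ?O"
      then obtain c where "y \<in> ball c 1" "ball c 1 \<inter> ball x r \<inter> path_image g = {}"
        using r(2)[of y] opens(4) by blast
      then show "\<exists>c. y \<in> ball c 1 \<and> ball c 1 \<inter> ball x r \<inter> ?R = {}"
        using one_side[of c] y opens(3) by blast
    qed
  qed
  show "locally_drawable ?R"
    unfolding locally_drawable_def locally_drawable_with_def
  proof
    fix x
    show "\<exists>U. open U \<and> x \<in> U \<and> (\<exists>D. drawable_with open_nbhd D \<and> U \<inter> ?R = U \<inter> D)"
    proof (cases "x \<in> path_image g")
      case True
      then obtain r where r: "r > 0"
        "\<And>y. y \<in> ball x r \<inter> ?R \<Longrightarrow> \<exists>c. y \<in> ball c 1 \<and> ball c 1 \<inter> ball x r \<subseteq> ?R"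
        using on by meson
      define A where "A = {c. ball c 1 \<inter> ball x r \<subseteq> ?R}"
      have "open_nbhd A = (\<Union>c\<in>A. ball c 1)" by (auto simp: open_nbhd_def dist_commute)
      then have "ball x r \<inter> ?R = ball x r \<inter> open_nbhd A"
        using r(2) unfolding A_def by blast
      moreover have "drawable_with open_nbhd (open_nbhd A)"
        unfolding drawable_with_def by (rule exI[of _ 1]) simp
      ultimately show ?thesis using r(1) by (intro exI[of _ "ball x r"]) auto
    qed (rule off[OF _ all(1) none(1)])
  qed
  show "locally_cdrawable ?R"
    unfolding locally_cdrawable_def locally_drawable_with_def
  proof
    fix x
    show "\<exists>U. open U \<and> x \<in> U \<and> (\<exists>D. drawable_with closed_nbhd D \<and> U \<inter> ?R = U \<inter> D)"
    proof (cases "x \<in> path_image g")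
      case True
      then obtain r where r: "r > 0"
        "\<And>y. y \<in> ball x r \<inter> ?O \<Longrightarrow> \<exists>c. y \<in> ball c 1 \<and> ball c 1 \<inter> ball x r \<inter> ?R = {}"
        using on by meson
      define A where "A = {c. ball c 1 \<inter> (ball x r \<inter> ?R) = {}}"
      have A_eq: "A = (\<Inter>z\<in>ball x r \<inter> ?R. - ball z 1)" by (auto simp: A_def dist_commute)
      \<comment> \<open>Closedness makes limits of admissible centres admissible; this is how the
        erased disks reach the points of the curve itself.\<close>
      have "closed A" unfolding A_eq by (intro closed_INT) auto
      have "y \<in> closed_nbhd A" if y: "y \<in> ball x r" "y \<notin> ?R" for y
      proof -
        \<comment> \<open>Since \<open>y\<close> may lie on the curve, it is approached by outside
          points; the centres of their disks are bounded and have a limit point in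
          \<open>A\<close>.\<close>
        have "y \<in> closure ?O" using y(2) opens(4) unfolding closure_Un_frontier opens(5) by blast
        then obtain f where f: "\<And>n. f n \<in> ?O" "f \<longlonglongrightarrow> y" unfolding closure_sequential by blast
        have "eventually (\<lambda>n. f n \<in> ball x r) sequentially"
          using f(2) y(1) by (rule topological_tendstoD[OF _ open_ball])
        then obtain k where k: "\<And>n. n \<ge> k \<Longrightarrow> f n \<in> ball x r" by (auto simp: eventually_sequentially)
        have "\<exists>c. c \<in> A \<and> f (n + k) \<in> ball c 1" for n
          using r(2)[of "f (n + k)"] k[of "n + k"] f(1)[of "n + k"] unfolding A_def by (auto simp: Int_assoc)
        then obtain c where c: "\<And>n. c n \<in> A" "\<And>n. f (n + k) \<in> ball (c n) 1" by metis
        have fk: "(\<lambda>n. f (n + k)) \<longlonglongrightarrow> y" using f(2) by (rule LIMSEQ_ignore_initial_segment)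
        have "bounded (range c)"
        proof -
          obtain B where B: "\<And>n. norm (f (n + k)) \<le> B"
            using convergent_imp_bounded[OF fk] by (auto simp: bounded_iff)
          have "norm (c n) \<le> B + 1" for n
          proof -
            have "norm (c n) \<le> norm (c n - f (n + k)) + norm (f (n + k))" by norm
            then show ?thesis using c(2)[of n] B[of n] by (simp add: dist_norm)
          qed
          then show ?thesis by (auto simp: bounded_iff)
        qed
        then obtain l s where s: "strict_mono s" "(c \<circ> s) \<longlonglongrightarrow> l"
          using bounded_imp_convergent_subsequence[of c] by blast
        have "l \<in> A" using closed_sequentially[OF \<open>closed A\<close> _ s(2)] c(1) by simp
        have "(\<lambda>n. dist (f (s n + k)) (c (s n))) \<longlonglongrightarrow> dist y l"
          using LIMSEQ_subseq_LIMSEQ[OF fk s(1)] s(2) by (intro tendsto_dist) (auto simp: o_def)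
        then have "dist y l \<le> 1"
          by (rule LIMSEQ_le_const2) (use c(2) less_imp_le in \<open>auto simp: dist_commute\<close>)
        then show ?thesis using \<open>l \<in> A\<close> by (auto simp: closed_nbhd_def)
      qed
      \<comment> \<open>A closed disk that meets the open set \<open>ball x r \<inter> ?R\<close>
        already meets it with its interior.\<close>
      moreover have "y \<notin> ?R" if y: "y \<in> ball x r" "y \<in> closed_nbhd A" for y
      proof
        assume "y \<in> ?R"
        obtain c where c: "c \<in> A" "y \<in> cball c 1" using y(2) by (auto simp: closed_nbhd_def dist_commute)
        have "open (ball x r \<inter> ?R)" using opens(1) by blast
        moreover have "y \<in> closure (ball c 1)" using c(2) by simp
        ultimately have "ball x r \<inter> ?R \<inter> ball c 1 \<noteq> {}"
          using open_Int_closure_eq_empty[of "ball x r \<inter> ?R" "ball c 1"] y(1) \<open>y \<in> ?R\<close> by blast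
        then show False using c(1) unfolding A_def by blast
      qed
      ultimately have "ball x r \<inter> ?R = ball x r \<inter> (UNIV - closed_nbhd A)" by blast
      \<comment> \<open>Level 2 suffices: one stroke fills the plane, one erases.\<close>
      moreover have "drawable_with closed_nbhd (UNIV - closed_nbhd A)"
        unfolding drawable_with_def
        by (rule exI[of _ 2]) (use nbhd_UNIV in \<open>force simp: numeral_2_eq_2\<close>)
      ultimately show ?thesis using r(1) by (intro exI[of _ "ball x r"]) auto
    qed (rule off[OF _ all(2) none(2)])
  qed
qed

subsection \<open>The gear-shaped loop\<close>

lemma has_vector_derivative_exp_wrap:
  fixes W :: "real \<Rightarrow> complex" and \<rho> :: real
  assumes "(W has_vector_derivative w) (at t)"
  shows "((\<lambda>t. \<rho> * exp (\<i> / \<rho> * W t)) has_vector_derivative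
    \<rho> * exp (\<i> / \<rho> * W t) * (\<i> / \<rho> * w)) (at t)"
proof -
  have "((\<lambda>z. \<rho> * exp (\<i> / \<rho> * z)) has_field_derivative \<rho> * (exp (\<i> / \<rho> * W t) * (\<i> / \<rho>))) (at (W t))"
    by (auto intro!: derivative_eq_intros)
  from field_vector_diff_chain_at[OF assms this] show ?thesis
    unfolding o_def by (rule has_vector_derivative_eq_rhs) (simp add: mult_ac)
qed

text \<open>The conformal map \<open>z \<mapsto> \<rho> exp (i z / \<rho>)\<close> wraps a horizontal strip onto an annulus;
  for large \<open>\<rho>\<close> it is nearly an isometry up to second order.\<close>

lemma curvature_exp_wrap:
  fixes W W' W'' :: "real \<Rightarrow> complex" and \<rho> :: real
  assumes W: "\<And>t. (W has_vector_derivative W' t) (at t)"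
    and W': "\<And>t. (W' has_vector_derivative W'' t) (at t)"
    and W'': "continuous_on UNIV W''"
    and nz: "\<And>t. W' t \<noteq> 0" and \<rho>: "\<rho> > 0"
  defines "g \<equiv> (\<lambda>t. \<rho> * exp (\<i> / \<rho> * W t))"
  shows "\<And>t. (g has_vector_derivative g t * (\<i> / \<rho> * W' t)) (at t)"
    and "\<And>t. ((\<lambda>s. vector_derivative g (at s)) has_vector_derivative
      g t * (\<i> / \<rho> * W'' t - (W' t / \<rho>)\<^sup>2)) (at t)"
    and "continuous_on UNIV (\<lambda>t. vector_derivative (\<lambda>s. vector_derivative g (at s)) (at t))"
    and "\<And>t. curvature g t = exp (Im (W t) / \<rho>) *
      (Im (cnj (W' t) * W'' t) / cmod (W' t) ^ 3 + Re (W' t) / (\<rho> * cmod (W' t)))"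
proof -
  show g1: "(g has_vector_derivative g t * (\<i> / \<rho> * W' t)) (at t)" for t
    unfolding g_def by (rule has_vector_derivative_exp_wrap[OF W])
  have v1: "(\<lambda>s. vector_derivative g (at s)) = (\<lambda>t. g t * (\<i> / \<rho> * W' t))"
    using g1 by (auto simp: fun_eq_iff intro: vector_derivative_at)
  have "((\<lambda>t. g t * (\<i> / \<rho> * W' t)) has_vector_derivative
      g t * (\<i> / \<rho> * W'' t) + (g t * (\<i> / \<rho> * W' t)) * (\<i> / \<rho> * W' t)) (at t)" for t
    by (intro has_vector_derivative_mult g1 has_vector_derivative_mult_right W')
  moreover have "g t * (\<i> / \<rho> * W'' t) + (g t * (\<i> / \<rho> * W' t)) * (\<i> / \<rho> * W' t) =
      g t * (\<i> / \<rho> * W'' t - (W' t / \<rho>)\<^sup>2)" for t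
    by (simp add: power2_eq_square algebra_simps)
  ultimately show g2: "((\<lambda>s. vector_derivative g (at s)) has_vector_derivative
      g t * (\<i> / \<rho> * W'' t - (W' t / \<rho>)\<^sup>2)) (at t)" for t
    unfolding v1 by simp
  have v2: "vector_derivative (\<lambda>s. vector_derivative g (at s)) (at t) = g t * (\<i> / \<rho> * W'' t - (W' t / \<rho>)\<^sup>2)" for t
    using g2 by (rule vector_derivative_at)
  have "continuous_on UNIV W" "continuous_on UNIV W'"
    using has_vector_derivative_continuous[OF W] has_vector_derivative_continuous[OF W']
    by (simp_all add: continuous_on_eq_continuous_at)
  then show "continuous_on UNIV (\<lambda>t. vector_derivative (\<lambda>s. vector_derivative g (at s)) (at t))"
    unfolding v2 unfolding g_def using \<rho> W'' by (intro continuous_intros) auto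
  fix t
  \<comment> \<open>\<open>e\<close> is the conformal factor of the wrap at \<open>W t\<close>. The
    curvature is divided by it; the summand with \<open>Re (W' t)\<close> comes from the bending of
    the axis into a circle.\<close>
  define e where "e = exp (- Im (W t) / \<rho>)"
  have e: "e > 0" "cmod (g t) = \<rho> * e"
    using \<rho> by (auto simp: e_def g_def norm_mult Re_divide_of_real)
  have "cnj (g t * (\<i> / \<rho> * W' t)) * (g t * (\<i> / \<rho> * W'' t - (W' t / \<rho>)\<^sup>2)) =
      (g t * cnj (g t)) * (cnj (\<i> / \<rho> * W' t) * (\<i> / \<rho> * W'' t - (W' t / \<rho>)\<^sup>2))"
    by (simp add: mult_ac)
  also have "\<dots> = of_real ((\<rho> * e)\<^sup>2) * (cnj (\<i> / \<rho> * W' t) * (\<i> / \<rho> * W'' t - (W' t / \<rho>)\<^sup>2))"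
    by (simp add: complex_norm_square[symmetric] e)
  also have "\<dots> = of_real (e\<^sup>2) * (cnj (W' t) * W'' t + \<i> / \<rho> * (W' t * cnj (W' t)) * W' t)"
    using \<rho> by (simp add: field_simps power2_eq_square)
  also have "\<dots> = of_real (e\<^sup>2) * (cnj (W' t) * W'' t + \<i> * of_real ((cmod (W' t))\<^sup>2 / \<rho>) * W' t)"
    by (simp add: complex_norm_square[symmetric])
  finally have eq: "cnj (g t * (\<i> / \<rho> * W' t)) * (g t * (\<i> / \<rho> * W'' t - (W' t / \<rho>)\<^sup>2)) =
      of_real (e\<^sup>2) * (cnj (W' t) * W'' t + \<i> * of_real ((cmod (W' t))\<^sup>2 / \<rho>) * W' t)" .
  have "Im (cnj (g t * (\<i> / \<rho> * W' t)) * (g t * (\<i> / \<rho> * W'' t - (W' t / \<rho>)\<^sup>2))) =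
      e\<^sup>2 * (Im (cnj (W' t) * W'' t) + (cmod (W' t))\<^sup>2 / \<rho> * Re (W' t))"
    unfolding eq by (simp del: of_real_power of_real_divide)
  moreover have "cmod (g t * (\<i> / \<rho> * W' t)) = e * cmod (W' t)"
    using \<rho> e by (simp add: norm_mult norm_divide)
  ultimately have "curvature g t = e\<^sup>2 * (Im (cnj (W' t) * W'' t) + (cmod (W' t))\<^sup>2 / \<rho> * Re (W' t)) / (e * cmod (W' t)) ^ 3"
    unfolding curvature_def Let_def v2 using v1 by (metis)
  also have "\<dots> = (1 / e) * (Im (cnj (W' t) * W'' t) / cmod (W' t) ^ 3 + Re (W' t) / (\<rho> * cmod (W' t)))"
    using e(1) \<rho> nz[of t] by (simp add: field_simps power2_eq_square power3_eq_cube)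
  also have "1 / e = exp (Im (W t) / \<rho>)" by (simp add: e_def exp_minus inverse_eq_divide)
  finally show "curvature g t = exp (Im (W t) / \<rho>) *
      (Im (cnj (W' t) * W'' t) / cmod (W' t) ^ 3 + Re (W' t) / (\<rho> * cmod (W' t)))" .
qed

text \<open>A periodic wave along the real axis whose strands overhang: at each zero of
  \<open>sin\<close> the horizontal velocity is \<open>-1\<close>. The coefficients keep the curvature below 1
  while consecutive crossings of the axis lie only \<open>pi / 2\<close> apart.\<close>

definition meander :: "real \<Rightarrow> complex" where
  "meander x = Complex (x / 2 - 3 / 4 * sin (2 * x)) (7 / 2 * sin x)"

definition meander' :: "real \<Rightarrow> complex" where
  "meander' x = Complex (1 / 2 - 3 / 2 * cos (2 * x)) (7 / 2 * cos x)"

definition meander'' :: "real \<Rightarrow> complex" where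
  "meander'' x = Complex (3 * sin (2 * x)) (- 7 / 2 * sin x)"

section \<open>Derivatives, speed and curvature of the meander\<close>

lemma has_vector_derivative_Complex:
  assumes "(f has_real_derivative a) (at t)" "(h has_real_derivative b) (at t)"
  shows "((\<lambda>t. Complex (f t) (h t)) has_vector_derivative Complex a b) (at t)"
  using assms by (simp add: has_vector_derivative_complex_iff has_real_derivative_iff_has_vector_derivative)

lemma meander_scaled_derivs:
  "((\<lambda>t. meander (\<omega> * t)) has_vector_derivative \<omega> *\<^sub>R meander' (\<omega> * t)) (at t)"
  "((\<lambda>t. \<omega> *\<^sub>R meander' (\<omega> * t)) has_vector_derivative \<omega>\<^sup>2 *\<^sub>R meander'' (\<omega> * t)) (at t)"
proof -
  have 1: "(meander has_vector_derivative meander' x) (at x)" for x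
    unfolding meander_def meander'_def
    by (rule has_vector_derivative_Complex) (auto intro!: derivative_eq_intros)
  have 2: "(meander' has_vector_derivative meander'' x) (at x)" for x
    unfolding meander''_def meander'_def
    by (rule has_vector_derivative_Complex) (auto intro!: derivative_eq_intros)
  have l: "((\<lambda>t. \<omega> * t) has_vector_derivative \<omega>) (at t)"
    unfolding has_real_derivative_iff_has_vector_derivative[symmetric] by (auto intro!: derivative_eq_intros)
  show "((\<lambda>t. meander (\<omega> * t)) has_vector_derivative \<omega> *\<^sub>R meander' (\<omega> * t)) (at t)"
    using vector_diff_chain_at[OF l 1] by (simp add: o_def)
  have "((\<lambda>t. meander' (\<omega> * t)) has_vector_derivative \<omega> *\<^sub>R meander'' (\<omega> * t)) (at t)"
    using vector_diff_chain_at[OF l 2] by (simp add: o_def)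
  from has_vector_derivative_scaleR[OF DERIV_const this, of \<omega>]
  show "((\<lambda>t. \<omega> *\<^sub>R meander' (\<omega> * t)) has_vector_derivative \<omega>\<^sup>2 *\<^sub>R meander'' (\<omega> * t)) (at t)"
    by (simp add: power2_eq_square)
qed

text \<open>The amplitude \<open>7 / 2\<close> makes the terms linear in \<open>(cos x)^2\<close>
  almost cancel, \<open>49/4 - 12 = 1/4\<close>, so the speed is at least 2 throughout.\<close>

lemma norm_meander': "(cmod (meander' x))\<^sup>2 = 4 + (cos x)\<^sup>2 / 4 + 9 * ((cos x)\<^sup>2)\<^sup>2"
  unfolding meander'_def cmod_power2 complex.sel cos_double_cos
  by (simp add: power2_eq_square algebra_simps)

lemma meander'_nonzero: "meander' x \<noteq> 0"
proof
  assume "meander' x = 0"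
  then have "4 + (cos x)\<^sup>2 / 4 + 9 * ((cos x)\<^sup>2)\<^sup>2 = 0" using norm_meander'[of x] by simp
  moreover have "(cos x)\<^sup>2 \<ge> 0" "((cos x)\<^sup>2)\<^sup>2 \<ge> 0" by auto
  ultimately show False by linarith
qed

text \<open>Squaring removes the odd power of \<open>sin x\<close> and leaves a polynomial
  inequality in \<open>u\<close>, the square of \<open>cos x\<close>, on \<open>[0, 1]\<close>. The
  bound \<open>19 / 20\<close> leaves room for the distortion by the wrap.\<close>

lemma curvature_meander: "\<bar>Im (cnj (meander' x) * meander'' x)\<bar> \<le> 19 / 20 * cmod (meander' x) ^ 3"
proof -
  define u where "u = (cos x)\<^sup>2"
  have u: "0 \<le> u" "u \<le> 1" by (auto simp: u_def abs_square_le_1)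
  have s: "(sin x)\<^sup>2 = 1 - u" by (simp add: u_def sin_squared_eq)
  have "Im (cnj (meander' x) * meander'' x) = - (7 / 2) * sin x * (2 + 3 * (cos x)\<^sup>2)"
    unfolding meander'_def meander''_def cos_double_cos sin_double
    by (simp add: power2_eq_square algebra_simps)
  then have "(Im (cnj (meander' x) * meander'' x))\<^sup>2 = 49 / 4 * (sin x)\<^sup>2 * (2 + 3 * u)\<^sup>2"
    by (simp add: power_mult_distrib u_def power2_eq_square)
  also have "\<dots> = 49 / 4 * (1 - u) * (2 + 3 * u)\<^sup>2" by (simp add: s)
  also have "\<dots> \<le> (361 / 400) * (4 + u / 4 + 9 * u\<^sup>2) ^ 3"
  proof -
    \<comment> \<open>The expansion at \<open>u = 0\<close> to first order; the omitted terms are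
      nonpositive.\<close>
    have "49 / 4 * (1 - u) * (2 + 3 * u)\<^sup>2 \<le> 49 + 98 * u"
    proof -
      have "49 + 98 * u - 49 / 4 * (1 - u) * (2 + 3 * u)\<^sup>2 = 49 / 4 * (3 * u\<^sup>2 + 9 * u ^ 3)"
        by (simp add: power2_eq_square power3_eq_cube field_simps)
      also have "\<dots> \<ge> 0" using u by simp
      finally show ?thesis by simp
    qed
    \<comment> \<open>\<open>u^2\<close> is bounded below by its tangent at \<open>1/9\<close>,
      chosen so that the coefficients of \<open>u\<close> on both sides nearly agree.\<close>
    also have "\<dots> \<le> (361 / 400) * (64 + 12 * u + 432 * u\<^sup>2)"
    proof -
      have "0 \<le> (u - 1/9)\<^sup>2" by simp
      then have "u\<^sup>2 \<ge> 2/9 * u - 1/81" by (simp add: power2_eq_square algebra_simps)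
      then show ?thesis using u by simp
    qed
    \<comment> \<open>The cube is expanded around 4 and cut off after first order.\<close>
    also have "64 + 12 * u + 432 * u\<^sup>2 \<le> (4 + u / 4 + 9 * u\<^sup>2) ^ 3"
    proof -
      define v where "v = u / 4 + 9 * u\<^sup>2"
      have "v \<ge> 0" using u by (simp add: v_def)
      have "(4 + u / 4 + 9 * u\<^sup>2) ^ 3 = (4 + v) ^ 3" by (simp add: v_def add.assoc)
      also have "\<dots> = 64 + 48 * v + 12 * v\<^sup>2 + v ^ 3"
        by (simp add: power2_eq_square power3_eq_cube algebra_simps)
      also have "\<dots> \<ge> 64 + 48 * v" using \<open>v \<ge> 0\<close> by simp
      finally show ?thesis by (simp add: v_def)
    qed
    finally show ?thesis by simp
  qed
  also have "\<dots> = (361 / 400) * ((cmod (meander' x))\<^sup>2) ^ 3"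
    by (simp add: norm_meander' u_def)
  also have "\<dots> = (19 / 20 * cmod (meander' x) ^ 3)\<^sup>2"
    by (simp add: power2_eq_square power3_eq_cube)
  finally show ?thesis by (simp flip: abs_le_square_iff)
qed

text \<open>A thousand periods of the wave close up on the circle of radius 500, because
  \<open>meander (x + 2 pi) = meander x + pi\<close>.\<close>

definition gear :: "real \<Rightarrow> complex" where
  "gear t = of_real 500 * exp (\<i> / of_real 500 * meander (2000 * pi * t))"

section \<open>The wrapped meander: embedding and curvature\<close>

lemmas gear_wrap = curvature_exp_wrap[OF meander_scaled_derivs[of "2000 * pi"], of 500, folded gear_def[abs_def]]

lemma gear_wrap_side_conditions:
  "continuous_on UNIV (\<lambda>t. (2000 * pi)\<^sup>2 *\<^sub>R meander'' (2000 * pi * t))"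
  "(2000 * pi) *\<^sub>R meander' (2000 * pi * t) \<noteq> 0"
  using meander'_nonzero by (auto simp: meander''_def Complex_eq intro!: continuous_intros)

lemma has_vector_derivative_gear:
  "(gear has_vector_derivative gear t * (\<i> / of_real 500 * (2000 * pi) *\<^sub>R meander' (2000 * pi * t))) (at t)"
  using gear_wrap(1)[OF gear_wrap_side_conditions] by (simp add: gear_def)

text \<open>A root satisfies \<open>|x| \<le> 3 < pi\<close>, and there \<open>sin x\<close> has the
  sign of \<open>x\<close>, so nonzero summands cannot cancel. The factor 3 arises in
  \<open>gear_eq_iff\<close> as four times the coefficient \<open>3 / 4\<close> of
  \<open>meander\<close>.\<close>

lemma add_3_sin_eq_0:
  fixes x :: real
  assumes "x + 3 * sin x = 0"
  shows "x = 0"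
proof (rule ccontr)
  assume "x \<noteq> 0"
  have "\<bar>x\<bar> \<le> 3" using assms abs_sin_le_one[of x] by linarith
  then have "\<bar>x\<bar> < pi" using pi_gt3 by linarith
  then have "sin \<bar>x\<bar> > 0" using \<open>x \<noteq> 0\<close> by (intro sin_gt_zero) auto
  then show False using assms \<open>x \<noteq> 0\<close> by (cases "x > 0") auto
qed

text \<open>Equal values mean that the meander points have equal height and differ horizontally by a
  multiple of \<open>1000 * pi\<close>. Equal height leaves two cases: \<open>x - y\<close> is a
  multiple of \<open>2 * pi\<close>, or \<open>x + y\<close> is an odd multiple of
  \<open>pi\<close>. The second, which compares strands running in opposite vertical directions, is
  settled by \<open>add_3_sin_eq_0\<close>.\<close>

lemma gear_eq_iff: "gear s = gear t \<longleftrightarrow> s - t \<in> \<int>"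
proof
  assume "s - t \<in> \<int>"
  then obtain k where k: "s = t + of_int k" by (auto elim!: Ints_cases simp: algebra_simps)
  define x where "x = 2000 * pi * s"
  define y where "y = 2000 * pi * t"
  have x: "x = y + 2 * pi * of_int (1000 * k)" "2 * x = 2 * y + 2 * pi * of_int (2000 * k)"
    by (simp_all add: x_def y_def k algebra_simps)
  have "sin x = sin y" "sin (2 * x) = sin (2 * y)"
    using x by (metis sin_cos_eq_iff cos_eq_periodic_intro)+
  then have "\<i> / of_real 500 * meander x = \<i> / of_real 500 * meander y + (of_int (2 * k) * pi) * \<i>"
    using x(1) by (simp add: meander_def complex_eq_iff field_simps)
  then show "gear s = gear t"
    unfolding gear_def x_def[symmetric] y_def[symmetric] by (metis exp_eq)
next
  assume eq: "gear s = gear t"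
  define x where "x = 2000 * pi * s"
  define y where "y = 2000 * pi * t"
  have "exp (\<i> / of_real 500 * meander x) = exp (\<i> / of_real 500 * meander y)"
    using eq by (simp add: gear_def x_def y_def)
  then obtain k where k: "\<i> / of_real 500 * meander x = \<i> / of_real 500 * meander y + (of_int (2 * k) * pi) * \<i>"
    unfolding exp_eq by blast
  from arg_cong[OF k, of Re] have sin: "sin x = sin y" by (simp add: meander_def)
  from arg_cong[OF k, of Im] have lin: "x - y - 3 / 2 * (sin (2 * x) - sin (2 * y)) = 2000 * pi * of_int k"
    by (simp add: meander_def field_simps)
  have "2 * sin ((x - y) / 2) * cos ((x + y) / 2) = 0" using sin sin_diff_sin[of x y] by simp
  then consider "sin ((x - y) / 2) = 0" | "cos ((x + y) / 2) = 0" by auto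
  then have "x - y = 2000 * pi * of_int k"
  proof cases
    case 1
    then obtain j :: int where "(x - y) / 2 = of_int j * pi" by (auto simp: sin_zero_iff_int2)
    then have "2 * x = 2 * y + 2 * pi * of_int (2 * j)" by (simp add: field_simps)
    then have "sin (2 * x) = sin (2 * y)" by (metis sin_cos_eq_iff cos_eq_periodic_intro)
    then show ?thesis using lin by simp
  next
    case 2
    then obtain j :: int where "(x + y) / 2 = of_int j * pi + pi / 2"
      unfolding cos_zero_iff_int2 by blast
    then have xy: "x + y = 2 * pi * of_int j + pi" by (simp add: field_simps)
    define d where "d = x - y"
    have "2 * x = (d + pi) + 2 * pi * of_int j" "2 * y = (pi - d) + 2 * pi * of_int j"
      using xy by (simp_all add: d_def algebra_simps)
    then have "sin (2 * x) = sin (d + pi)" "sin (2 * y) = sin (pi - d)"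
      by (metis sin_cos_eq_iff cos_eq_periodic_intro)+
    then have "d + 3 * sin d = 2000 * pi * of_int k" using lin by (simp add: d_def)
    moreover have "sin (d - 2 * pi * of_int (1000 * k)) = sin d"
      by (metis sin_cos_eq_iff cos_eq_periodic_intro diff_add_cancel)
    ultimately have "d - 2000 * pi * of_int k = 0"
      using add_3_sin_eq_0[of "d - 2000 * pi * of_int k"] by (simp add: mult.assoc)
    then show ?thesis by (simp add: d_def)
  qed
  then have "s - t = of_int k" by (simp add: x_def y_def right_diff_distrib[symmetric])
  then show "s - t \<in> \<int>" by simp
qed

text \<open>The wrap changes the curvature of the meander by at most \<open>1/500\<close> and then
  scales it by at most 1.02, and \<open>1.02 * (0.95 + 0.002) < 1\<close>.\<close>

lemma curvature_gear: "\<bar>curvature gear t\<bar> < 1"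
proof -
  let ?\<omega> = "2000 * pi" and ?x = "2000 * pi * t"
  define k where "k = Im (cnj (?\<omega> *\<^sub>R meander' ?x) * (?\<omega>\<^sup>2 *\<^sub>R meander'' ?x)) / cmod (?\<omega> *\<^sub>R meander' ?x) ^ 3"
  have curv: "curvature gear t = exp (Im (meander ?x) / 500) *
     (k + Re (?\<omega> *\<^sub>R meander' ?x) / (500 * cmod (?\<omega> *\<^sub>R meander' ?x)))"
    unfolding k_def using gear_wrap(4)[OF gear_wrap_side_conditions] by simp
  \<comment> \<open>Curvature is independent of the speed of the parametrisation, so the factor
    \<open>2000 * pi\<close> cancels.\<close>
  have scale: "Im (cnj (w *\<^sub>R a) * (w\<^sup>2 *\<^sub>R b)) / cmod (w *\<^sub>R a) ^ 3 = Im (cnj a * b) / cmod a ^ 3"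
    if "w > 0" for w :: real and a b
  proof -
    have "cnj (w *\<^sub>R a) * (w\<^sup>2 *\<^sub>R b) = (w ^ 3) *\<^sub>R (cnj a * b)"
      by (simp add: power2_eq_square power3_eq_cube scaleR_conv_of_real)
    then have "Im (cnj (w *\<^sub>R a) * (w\<^sup>2 *\<^sub>R b)) = w ^ 3 * Im (cnj a * b)"
      by (simp only: scaleR_complex.simps)
    moreover have "cmod (w *\<^sub>R a) ^ 3 = w ^ 3 * cmod a ^ 3" using that by (simp add: power_mult_distrib)
    ultimately show ?thesis using that by (simp only: mult_divide_mult_cancel_left_if) simp
  qed
  have "k = Im (cnj (meander' ?x) * meander'' ?x) / cmod (meander' ?x) ^ 3"
    unfolding k_def by (rule scale) simp
  then have "\<bar>k\<bar> \<le> 19 / 20"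
    using curvature_meander[of ?x] meander'_nonzero[of ?x] by (simp add: abs_divide divide_le_eq)
  moreover have "\<bar>Re (?\<omega> *\<^sub>R meander' ?x) / (500 * cmod (?\<omega> *\<^sub>R meander' ?x))\<bar> \<le> 1 / 500"
    using abs_Re_le_cmod[of "?\<omega> *\<^sub>R meander' ?x"] gear_wrap_side_conditions(2)[of t] by (simp add: abs_divide divide_simps abs_mult del: scaleR_complex.simps)
  ultimately have "\<bar>k + Re (?\<omega> *\<^sub>R meander' ?x) / (500 * cmod (?\<omega> *\<^sub>R meander' ?x))\<bar> \<le> 19 / 20 + 1 / 500"
    by linarith
  moreover have "exp (Im (meander ?x) / 500) \<le> 102 / 100"
  proof -
    have "Im (meander ?x) / 500 \<le> 1 / 100" by (simp add: meander_def) (use sin_le_one[of ?x] in linarith)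
    then have "exp (Im (meander ?x) / 500) \<le> exp (1 / 100)" by simp
    also have "\<dots> \<le> 1 + 1 / 100 + (1 / 100)\<^sup>2" by (rule exp_bound) auto
    finally show ?thesis by (simp add: power2_eq_square)
  qed
  ultimately have "\<bar>curvature gear t\<bar> \<le> 102 / 100 * (19 / 20 + 1 / 500)"
    unfolding curv abs_mult by (intro mult_mono) auto
  then show ?thesis by simp
qed

lemma C2_jordan_loop_gear: "C2_jordan_loop gear"
proof -
  note g1 = has_vector_derivative_gear
  have "path gear" unfolding path_def
    using g1 by (meson continuous_at_imp_continuous_on has_vector_derivative_continuous)
  moreover have "loop_free gear" unfolding loop_free_def gear_eq_iff
  proof (intro ballI impI)
    fix x y :: real
    assume xy: "x \<in> {0..1}" "y \<in> {0..1}" "x - y \<in> \<int>"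
    then obtain k where k: "x - y = of_int k" by (auto elim: Ints_cases)
    then have "-1 \<le> k" "k \<le> 1" using xy by auto
    then consider "k = -1" | "k = 0" | "k = 1" by linarith
    then show "x = y \<or> x = 0 \<and> y = 1 \<or> x = 1 \<and> y = 0" using k xy by cases auto
  qed
  moreover have "vector_derivative gear (at t) \<noteq> 0" for t
    using vector_derivative_at[OF g1[of t]] meander'_nonzero by (simp add: gear_def)
  moreover have "gear differentiable (at t)" for t
    using g1 differentiableI_vector by blast
  moreover have "(\<lambda>s. vector_derivative gear (at s)) differentiable (at t)" for t
    using gear_wrap(2)[OF gear_wrap_side_conditions] differentiableI_vector by fastforce
  moreover have "continuous_on UNIV (\<lambda>t. vector_derivative (\<lambda>s. vector_derivative gear (at s)) (at t))"
    using gear_wrap(3)[OF gear_wrap_side_conditions] by simp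
  moreover have "gear (t + 1) = gear t" "pathfinish gear = pathstart gear" for t
    by (auto simp: gear_eq_iff pathfinish_def pathstart_def)
  ultimately show ?thesis unfolding C2_jordan_loop_def simple_path_def by blast
qed

section \<open>Crossings of the gear with the circle\<close>

lemma gear_node: "gear (of_int j / 2000) = 500 * cis (of_int j * pi / 1000)"
proof -
  \<comment> \<open>At multiples of \<open>pi\<close> both sines vanish, so the crossings of the
    axis are spaced \<open>pi / 2\<close> apart; the wrap keeps this spacing along the
    circle.\<close>
  have "sin (pi * of_int j) = 0" "sin (2 * (pi * of_int j)) = 0"
    using sin_npi_int sin_npi_int[of "2 * j"] by (auto simp: mult_ac)
  then have "meander (pi * of_int j) = of_real (pi * of_int j / 2)"
    by (simp add: meander_def complex_eq_iff)
  then have "\<i> / of_real 500 * meander (pi * of_int j) = \<i> * of_real (of_int j * pi / 1000)" by (simp only:) simp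
  moreover have "2000 * pi * (of_int j / 2000) = pi * of_int j" by simp
  ultimately show ?thesis unfolding gear_def cis_conv_exp by (simp only: of_real_numeral)
qed

text \<open>After rotation by \<open>e\<close> the crossing is 500, with the radial direction real
  and the circle direction imaginary. The curve crosses steeply, so each tangent disk has its centre
  displaced by about 0.96 along the circle and 0.27 radially. The neighbour on that side is about
  1.57 away along the circle, hence well within distance 1 of the centre.\<close>

lemma tangent_disks_contain_neighbour:
  assumes "dist c (gear (of_int j / 2000)) = 1"
    and "(c - gear (of_int j / 2000)) \<bullet> vector_derivative gear (at (of_int j / 2000)) = 0"
  shows "ball c 1 \<inter> range (\<lambda>j. gear (of_int j / 2000)) \<noteq> {}"
proof -
  let ?\<omega> = "2000 * pi" and ?t = "of_int j / 2000 :: real"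
  define e where "e = cis (of_int j * pi / 1000)"
  define m where "m = meander' (pi * of_int j)"
  define \<sigma> where "\<sigma> = cos (pi * of_int j)"
  define \<delta> where "\<delta> = pi / 1000"
  define q where "q = cmod m"
  have \<sigma>: "\<sigma> = 1 \<or> \<sigma> = -1" "\<sigma>\<^sup>2 = 1"
    using cos_int_times_real sin_npi_int[of j] sin_cos_squared_add[of "pi * of_int j"]
    by (auto simp: \<sigma>_def mult_ac power2_eq_1_iff)
  have m: "m = Complex (-1) (7 / 2 * \<sigma>)"
    using \<sigma>(2) by (simp add: m_def meander'_def \<sigma>_def cos_double_cos)
  have q: "q\<^sup>2 = 53 / 4" unfolding q_def cmod_power2 m using \<sigma>(2) by (simp add: power_mult_distrib power2_eq_square)
  have "q > 0" using q unfolding q_def by (cases "m = 0") auto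
  have "vector_derivative gear (at ?t) = gear ?t * (\<i> / of_real 500 * ?\<omega> *\<^sub>R meander' (?\<omega> * ?t))"
    by (rule vector_derivative_at[OF has_vector_derivative_gear])
  also have "\<dots> = ?\<omega> *\<^sub>R (\<i> * e * m)"
    by (simp add: gear_node e_def m_def scaleR_conv_of_real)
  finally have vd: "vector_derivative gear (at ?t) = ?\<omega> *\<^sub>R (\<i> * e * m)" .
  have "e \<noteq> 0" "m \<noteq> 0" using \<open>q > 0\<close> by (auto simp: e_def q_def)
  obtain \<epsilon>' :: real where \<epsilon>': "\<epsilon>' = 1 \<or> \<epsilon>' = -1"
    "c - gear ?t = \<epsilon>' *\<^sub>R (\<i> * sgn (?\<omega> *\<^sub>R (\<i> * e * m)))"
    using unit_normal_cases[of "c - gear ?t" "?\<omega> *\<^sub>R (\<i> * e * m)"] assms \<open>e \<noteq> 0\<close> \<open>m \<noteq> 0\<close>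
    unfolding vd dist_norm by auto
  \<comment> \<open>The sign flips because the \<open>\<i>\<close> of the normal multiplies the
    \<open>\<i>\<close> in the derivative of the wrap.\<close>
  define \<epsilon> where "\<epsilon> = - \<epsilon>'"
  have "sgn (?\<omega> *\<^sub>R (\<i> * e * m)) = \<i> * e * m / q"
    unfolding sgn_scaleR by (simp add: sgn_mult sgn_eq[of m] sgn_eq[of e] q_def) (simp add: sgn_eq e_def)
  then have \<epsilon>: "\<epsilon> = 1 \<or> \<epsilon> = -1" "c = 500 * e + \<epsilon> *\<^sub>R (e * m / q)"
    using \<epsilon>' unfolding gear_node e_def[symmetric] by (auto simp: \<epsilon>_def algebra_simps)
  \<comment> \<open>\<open>k\<close> is the sign \<open>\<epsilon> * \<sigma>\<close> of the
    displacement of the centre along the circle, which selects the neighbour on that side.\<close>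
  define k :: int where "k = (if \<epsilon> = \<sigma> then 1 else -1)"
  have node: "gear (of_int (j + k) / 2000) = 500 * e * cis (of_int k * \<delta>)"
    unfolding gear_node by (simp add: e_def \<delta>_def cis_mult distrib_right add_divide_distrib mult.assoc)
  have "gear (of_int (j + k) / 2000) - c = e * (500 * (cis (of_int k * \<delta>) - 1) - \<epsilon> *\<^sub>R (m / q))"
    unfolding node \<epsilon>(2) by (simp add: algebra_simps scaleR_conv_of_real)
  then have "dist c (gear (of_int (j + k) / 2000)) = cmod (500 * (cis (of_int k * \<delta>) - 1) - \<epsilon> *\<^sub>R (m / q))"
    by (simp add: dist_norm norm_minus_commute[of c] norm_mult e_def)
  moreover have "500 * (cis (of_int k * \<delta>) - 1) - \<epsilon> *\<^sub>R (m / q) =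
      Complex (\<epsilon> / q - 500 * (1 - cos \<delta>)) (of_int k * (500 * sin \<delta> - 7 / 2 / q))"
    using \<epsilon>(1) \<sigma>(1) by (auto simp: k_def m complex_eq_iff Re_divide_of_real Im_divide_of_real algebra_simps)
  moreover have "(of_int k)\<^sup>2 = (1::real)" by (simp add: k_def)
  ultimately have D: "(dist c (gear (of_int (j + k) / 2000)))\<^sup>2 =
      (\<epsilon> / q - 500 * (1 - cos \<delta>))\<^sup>2 + (500 * sin \<delta> - 7 / 2 / q)\<^sup>2"
    by (simp add: cmod_power2 power_mult_distrib)
  \<comment> \<open>\<open>q\<close> is about 3.64; the estimates place the displacement of the
    centre along the circle in \<open>[0.9, 1]\<close>.\<close>
  have q1: "1 / q \<le> 1 / 3" "1 \<le> 7 / 2 / q + 1 / 10" "7 / 2 / q \<le> 1"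
  proof -
    have "q \<ge> 7 / 2" by (rule power2_le_imp_le) (use q \<open>q > 0\<close> in \<open>auto simp: power2_eq_square\<close>)
    moreover have "q \<le> 37 / 10" by (rule power2_le_imp_le) (use q in \<open>auto simp: power2_eq_square\<close>)
    ultimately show "1 / q \<le> 1 / 3" "1 \<le> 7 / 2 / q + 1 / 10" "7 / 2 / q \<le> 1"
      using \<open>q > 0\<close> by (auto simp: field_simps)
  qed
  have \<delta>: "0 < \<delta>" "31 / 10000 \<le> \<delta>" "\<delta> \<le> 32 / 10000" using pi_approx by (auto simp: \<delta>_def)
  \<comment> \<open>These bounds put \<open>500 * sin \<delta>\<close> between 1.5 and 1.6, so it
    differs from a number in \<open>[0.9, 1]\<close> by at most \<open>7/10\<close>.\<close>
  have s: "0 \<le> sin \<delta>" "sin \<delta> \<le> \<delta>" "sin \<delta> \<ge> 3 / 1000"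
  proof -
    show "sin \<delta> \<le> \<delta>" using sin_x_le_x \<delta>(1) by simp
    have "\<bar>sin \<delta> - (\<Sum>m<3. sin_coeff m * \<delta> ^ m)\<bar> \<le> inverse (fact 3) * \<bar>\<delta>\<bar> ^ 3"
      by (rule Maclaurin_sin_bound)
    then have "\<bar>sin \<delta> - \<delta>\<bar> * 6 \<le> \<delta> ^ 3"
      using \<delta>(1) by (simp add: eval_nat_numeral sin_coeff_def)
    moreover have "\<delta> ^ 3 \<le> (32 / 10000) ^ 3" using \<delta> by (intro power_mono) auto
    ultimately show "sin \<delta> \<ge> 3 / 1000" using \<delta>(2) by (simp add: power3_eq_cube abs_if split: if_splits)
    then show "0 \<le> sin \<delta>" by simp
  qed
  have co: "0 \<le> 1 - cos \<delta>" "1 - cos \<delta> \<le> 1 / 90000"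
  proof -
    show "0 \<le> 1 - cos \<delta>" by simp
    have "cos \<delta> \<ge> 0" by (rule cos_ge_zero) (use \<delta> pi_gt3 in auto)
    then have "(cos \<delta>)\<^sup>2 \<le> cos \<delta>" by (simp add: power2_eq_square mult_left_le)
    then have "1 - cos \<delta> \<le> (sin \<delta>)\<^sup>2" using sin_cos_squared_add[of \<delta>] by linarith
    also have "\<dots> \<le> (1 / 300)\<^sup>2" using s \<delta> by (intro power_mono) auto
    finally show "1 - cos \<delta> \<le> 1 / 90000" by (simp add: power2_eq_square)
  qed
  \<comment> \<open>\<open>1 / 180\<close> is \<open>500 / 90000\<close>, the bound for the radial
    sag of the circle between neighbouring crossings.\<close>
  have "\<bar>a - b\<bar> \<le> 1 / 2" if "\<bar>a\<bar> \<le> 1 / 3" "0 \<le> b" "b \<le> 1 / 180" for a b :: real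
    using that by linarith
  moreover have "\<bar>\<epsilon> / q\<bar> \<le> 1 / 3" using \<epsilon>(1) q1(1) \<open>q > 0\<close> by auto
  ultimately have "\<bar>\<epsilon> / q - 500 * (1 - cos \<delta>)\<bar> \<le> 1 / 2" using co by simp
  then have "(\<epsilon> / q - 500 * (1 - cos \<delta>))\<^sup>2 \<le> (1 / 2)\<^sup>2"
    by (simp add: abs_le_square_iff[symmetric])
  moreover have "\<bar>500 * sin \<delta> - 7 / 2 / q\<bar> \<le> 7 / 10"
    using s \<delta> q1 by (auto simp: abs_le_iff)
  then have "(500 * sin \<delta> - 7 / 2 / q)\<^sup>2 \<le> (7 / 10)\<^sup>2"
    by (simp add: abs_le_square_iff[symmetric])
  \<comment> \<open>Numerically, \<open>(1/2)^2 + (7/10)^2 = 0.74\<close>.\<close>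
  ultimately have "(dist c (gear (of_int (j + k) / 2000)))\<^sup>2 < 1\<^sup>2"
    unfolding D by (simp add: power2_eq_square)
  then have "dist c (gear (of_int (j + k) / 2000)) < 1" by (rule power2_less_imp_less) simp
  then have "gear (of_int (j + k) / 2000) \<in> ball c 1" by (simp only: mem_ball)
  then show ?thesis by blast
qed

section \<open>Assembly of the tubes around all crossings\<close>

theorem theorem1p2:
  shows "\<exists>g. C2_jordan_loop g \<and> (\<forall>t. -1 < curvature g t \<and> curvature g t < 1) \<and>
     \<not> drawable (inside (path_image g)) \<and> \<not> cdrawable (inside (path_image g)) \<and>
     locally_drawable (inside (path_image g)) \<and> locally_cdrawable (inside (path_image g))"
proof -
  let ?R = "inside (path_image gear)"
  let ?S = "range (\<lambda>j. gear (of_int j / 2000))"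
  let ?g' = "\<lambda>t. vector_derivative gear (at t)"
  note J = C2_jordan_loop_gear
  have curv: "-1 < curvature gear t \<and> curvature gear t < 1" for t
    using curvature_gear[of t] by (auto simp: abs_less_iff)
  have fr: "frontier ?R = range gear"
    using Jordan_inside_outside[of gear] J range_eq_path_image[OF J] by (simp add: C2_jordan_loop_def)
  have g: "(gear has_vector_derivative ?g' t) (at t)" for t
    using J by (simp add: C2_jordan_loop_def vector_derivative_works)
  have "continuous_on UNIV ?g'"
    using J unfolding C2_jordan_loop_def
    by (meson continuous_at_imp_continuous_on differentiable_imp_continuous_within)
  then have "\<exists>N. open N \<and> gear (of_int j / 2000) \<in> N \<and> (\<forall>c. cball c 1 \<inter> N \<noteq> {} \<longrightarrow>
      ball c 1 \<inter> N \<inter> range gear \<noteq> {} \<or> ball c 1 \<inter> ?S \<noteq> {})" for j :: int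
    by (intro trap_neighbourhood[OF g] tangent_disks_contain_neighbour)
  then obtain N where N: "\<And>j. open (N j)" "\<And>j::int. gear (of_int j / 2000) \<in> N j"
    "\<And>j c. cball c 1 \<inter> N j \<noteq> {} \<Longrightarrow> ball c 1 \<inter> N j \<inter> range gear \<noteq> {} \<or> ball c 1 \<inter> ?S \<noteq> {}"
    by metis
  \<comment> \<open>A disk that enters \<open>N j\<close> without crossing the curve there contains
    some crossing. That crossing lies on the curve and in its own tube, hence in the union; so the
    tubes form a trap only jointly.\<close>
  have trap: "ball c 1 \<inter> (\<Union>j. N j) \<inter> frontier ?R \<noteq> {}" if c: "cball c 1 \<inter> (\<Union>j. N j) \<noteq> {}" for c
  proof -
    obtain j where "cball c 1 \<inter> N j \<noteq> {}" using c by blast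
    then show ?thesis using N(2) N(3)[of c j] unfolding fr by blast
  qed
  have "open (\<Union>j. N j)" "(\<Union>j. N j) \<noteq> {}" using N(1,2) by blast+
  then show ?thesis
    using J curv not_drawable_if_trap[OF _ _ trap] locally_drawable_inside[OF J curv] by blast
qed

end
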